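(* Assume (A1), (A2), and that $\{\gamma_n\}_{n\ge1}$ is a deterministic $[0,1)$-valued non-increasing sequence with $\lim_n\gamma_n=0$. Then for the linearized Wang–Landau algorithm, $$\mathbb P\Big(\limsup_{n\to\infty}\underline\theta_n>0\Big)=1,\qquad\text{where }\underline\theta_n=\min_{1\le j\le d}\theta_n(j).$$
   Context: Let $(\mathsf X,\mathcal X)$ be a Polish space with its Borel $\sigma$-algebra, endowed with a $\sigma$-finite reference measure $\lambda$, and let $\pi$ be a probability density with respect to $\lambda$. Let $d\ge 2$ and let $\mathsf X_1,\dots,\mathsf X_d$ be a measurable partition of $\mathsf X$; let $I:\mathsf X\to\{1,\dots,d\}$ be defined by $I(x)=i$ iff $x\in\mathsf X_i$. Set $\theta_\star(i)=\int_{\mathsf X_i}\pi\,d\lambda$. Let $\Theta=\{\theta\in(0,1)^d:\sum_i\theta(i)=1\}$. For $\theta\in\Theta$, $\pi_\theta(x)=\big(\sum_{i}\theta_\star(i)/\theta(i)\big)^{-1}\sum_{i}\frac{\pi(x)}{\theta(i)}\mathbf 1_{\mathsf X_i}(x)$. (A1): $0<\inf_{\mathsf X}\pi\le\sup_{\mathsf X}\pi<\infty$ and $\min_i\theta_\star(i)>0$. (A2): for each $\theta\in\Theta$, $P_\theta$ is the Metropolis–Hastings kernel with target $\pi_\theta\,d\lambda$ and symmetric proposal density $q(x,y)$ w.r.t. $\lambda$ with $\inf_{\mathsf X^2}q>0$, acceptance probability $\alpha_\theta(x,y)=1\wedge(\pi_\theta(y)/\pi_\theta(x))$. Linearized Wang–Landau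 algorithm: given $X_0\in\mathsf X$, $\theta_0\in\Theta$ and step sizes $\gamma_n\in[0,1)$, for $n\ge0$ draw $X_{n+1}$ from $P_{\theta_n}(X_n,\cdot)$ conditionally on $\mathcal F_n=\sigma(\theta_0,X_0,\dots,X_n)$, and set $\theta_{n+1}=\theta_n+\gamma_{n+1}H(X_{n+1},\theta_n)$ where $H_i(x,\theta)=\theta(i)\big(\mathbf 1_{\mathsf X_i}(x)-\theta(I(x))\big)$. (Equivalently, with $i=I(X_{n+1})$: $\theta_{n+1}(i)=\theta_n(i)+\gamma_{n+1}\theta_n(i)(1-\theta_n(i))$ and $\theta_{n+1}(k)=\theta_n(k)-\gamma_{n+1}\theta_n(k)\theta_n(i)$ for $k\ne i$.) Then $\theta_n\in\Theta$ for all $n$. *)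

theory Defs
  imports "HOL-Probability.Probability"
begin

text \<open>Index set of the partition: strata are numbered 1..d; the stratum map
  I sends x to the unique i with x in X_i.\<close>

definition theta_star :: "'a measure \<Rightarrow> ('a \<Rightarrow> real) \<Rightarrow> ('a \<Rightarrow> nat) \<Rightarrow> nat \<Rightarrow> real" where
  "theta_star lam p I i = (LINT x:{x \<in> space lam. I x = i}|lam. p x)"

definition Theta :: "nat \<Rightarrow> (nat \<Rightarrow> real) set" where
  "Theta d = {th. (\<forall>i\<in>{1..d}. 0 < th i \<and> th i < 1) \<and> (\<Sum>i=1..d. th i) = 1}"

definition pi_theta :: "'a measure \<Rightarrow> ('a \<Rightarrow> real) \<Rightarrow> ('a \<Rightarrow> nat) \<Rightarrow> nat
    \<Rightarrow> (nat \<Rightarrow> real) \<Rightarrow> 'a \<Rightarrow> real" where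
  "pi_theta lam p I d th x =
     inverse (\<Sum>i=1..d. theta_star lam p I i / th i) * (p x / th (I x))"

text \<open>Metropolis--Hastings kernel with target density ptar (w.r.t. lam) and
  symmetric proposal density q: P(x,B).\<close>
definition MH_kernel :: "'a measure \<Rightarrow> ('a \<Rightarrow> 'a \<Rightarrow> real) \<Rightarrow> ('a \<Rightarrow> real) \<Rightarrow> 'a \<Rightarrow> 'a set \<Rightarrow> real" where
  "MH_kernel lam q ptar x B =
     (LINT y:B|lam. q x y * min 1 (ptar y / ptar x))
     + (1 - (LINT y|lam. q x y * min 1 (ptar y / ptar x))) * indicator B x"

definition H_WL :: "('a \<Rightarrow> nat) \<Rightarrow> 'a \<Rightarrow> (nat \<Rightarrow> real) \<Rightarrow> nat \<Rightarrow> real" where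
  "H_WL I x th i = th i * ((if I x = i then 1 else 0) - th (I x))"

primrec theta_seq :: "(nat \<Rightarrow> real) \<Rightarrow> ('a \<Rightarrow> nat) \<Rightarrow> (nat \<Rightarrow> real) \<Rightarrow> (nat \<Rightarrow> 'a) \<Rightarrow> nat \<Rightarrow> nat \<Rightarrow> real" where
  "theta_seq gam I th0 Xs 0 = th0"
| "theta_seq gam I th0 Xs (Suc n) =
     (\<lambda>i. theta_seq gam I th0 Xs n i + gam (Suc n) * H_WL I (Xs (Suc n)) (theta_seq gam I th0 Xs n) i)"

definition F_gen :: "'b measure \<Rightarrow> nat \<Rightarrow> (nat \<Rightarrow> 'b \<Rightarrow> 'a::topological_space)
    \<Rightarrow> ('b \<Rightarrow> nat \<Rightarrow> real) \<Rightarrow> nat \<Rightarrow> 'b set set" where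
  "F_gen M d X th0 n =
     {X j -` C \<inter> space M | j C. j \<le> n \<and> C \<in> sets borel}
     \<union> {(\<lambda>w. th0 w i) -` C \<inter> space M | i C. i \<in> {1..d} \<and> C \<in> sets borel}"

end

(* The energy V_n = - sum_i ln theta_n(i) + gamma_n c theta_n(I(X_n))^s is nonnegative and tends to
   infinity when the smallest weight tends to 0, so it is enough that it is a supermartingale while
   the smallest weight is at most some epsilon. Its first term changes on average by
   gamma (d E[theta_n(I(X_{n+1}))] - 1), so the chain must spend little time in strata of large
   weight. The corrector encodes this: from a stratum of weight a the chain jumps to one of weight
   b > a with probability O(a/b), and to the lightest stratum with probability at least eta, hence
   theta(I(.))^s contracts for small s. Monotonicity of gamma makes the change of the prefactor of
   the corrector favourable. *)
theory Submission
  imports Defs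
begin


section \<open>One-step weight update and the energy\<close>

definition wl_step :: "real \<Rightarrow> nat \<Rightarrow> (nat \<Rightarrow> real) \<Rightarrow> nat \<Rightarrow> real" where
  "wl_step g j th i = th i * (1 + g * ((if j = i then 1 else 0) - th j))"

text \<open>The step size \<open>g\<close> and the current stratum \<open>j\<close> are arguments
  separate from \<open>th\<close>, because the drift compares energies taken at two consecutive step
  sizes and strata.\<close>

definition lyap :: "nat \<Rightarrow> real \<Rightarrow> real \<Rightarrow> real \<Rightarrow> nat \<Rightarrow> (nat \<Rightarrow> real) \<Rightarrow> real" where
  "lyap d c s g j th = - (\<Sum>i=1..d. ln (th i)) + g * c * th j powr s"

subsection \<open>The deterministic drift inequality\<close>

lemma theta_seq_Suc_eq_wl_step:
  "theta_seq gam I t Xs (Suc n) = wl_step (gam (Suc n)) (I (Xs (Suc n))) (theta_seq gam I t Xs n)"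
  by (auto simp: wl_step_def H_WL_def algebra_simps)

lemma ThetaD:
  assumes "th \<in> Theta d" "i \<in> {1..d}"
  shows "0 < th i" "th i < 1"
  using assms by (auto simp: Theta_def)

lemma wl_step_factor_pos:
  assumes "0 \<le> g" "g < 1" "0 < t" "t < (1::real)"
  shows "0 < 1 + g * ((if b then 1 else 0) - t)"
proof (cases b)
  case False
  have "g * t \<le> g * 1" using assms by (intro mult_left_mono) auto
  with False assms show ?thesis by auto
next
  case True
  have "0 \<le> g * (1 - t)" using assms by simp
  with True show ?thesis by simp
qed

lemma wl_step_in_Theta:
  assumes th: "th \<in> Theta d" and j: "j \<in> {1..d}" and g: "0 \<le> g" "g < 1" and d: "d \<ge> 2"
  shows "wl_step g j th \<in> Theta d"
proof -
  let ?u = "wl_step g j th"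
  have pos: "0 < ?u i" if "i \<in> {1..d}" for i
    unfolding wl_step_def
    using ThetaD[OF th that] ThetaD[OF th j] wl_step_factor_pos[OF g] by (intro mult_pos_pos) auto
  have eq: "?u i = th i + g * ((if j = i then th i else 0) - th i * th j)" for i
    by (simp add: wl_step_def algebra_simps)
  have s1: "(\<Sum>i=1..d. th i) = 1" using th by (simp add: Theta_def)
  have "(\<Sum>i=1..d. ?u i) = 1 + g * (th j - 1 * th j)"
    using j by (simp only: eq sum.distrib sum_distrib_left[symmetric] sum_subtractf
        sum_distrib_right[symmetric] s1) (simp add: sum.delta)
  then have s: "(\<Sum>i=1..d. ?u i) = 1" by simp
  have "?u i < 1" if i: "i \<in> {1..d}" for i
  proof -
    \<comment> \<open>Since \<open>d\<close> is at least 2 there is a second coordinate; its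
      positivity and the total mass 1 keep coordinate \<open>i\<close> strictly below 1.\<close>
    define k where "k = (if i = 1 then 2 else 1 :: nat)"
    have k: "k \<in> {1..d}" "k \<noteq> i" using d by (auto simp: k_def)
    have "?u i + ?u k = (\<Sum>m\<in>{i,k}. ?u m)" using k by simp
    also have "\<dots> \<le> (\<Sum>m=1..d. ?u m)"
      by (rule sum_mono2) (use k i pos in \<open>auto intro: less_imp_le\<close>)
    finally show ?thesis using pos[OF k(1)] s by linarith
  qed
  with pos s show ?thesis by (auto simp: Theta_def)
qed

text \<open>Weights below 1 have negative logarithms. Nonnegativity lets the energy be integrated in
  \<open>ennreal\<close> with no integrability condition.\<close>

lemma lyap_nonneg:
  assumes th: "th \<in> Theta d" and "0 \<le> g" "0 \<le> c"
  shows "0 \<le> lyap d c s g j th"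
proof -
  have "(\<Sum>i=1..d. ln (th i)) \<le> 0"
    using ThetaD[OF th] by (intro sum_nonpos) (auto simp: less_imp_le)
  moreover have "0 \<le> g * c * th j powr s" using assms by simp
  ultimately show ?thesis by (simp add: lyap_def)
qed

text \<open>All terms of the energy are nonnegative, so it dominates each of them. Hence it diverges
  when the smallest weight tends to 0.\<close>

lemma neg_ln_le_lyap:
  assumes th: "th \<in> Theta d" and i: "i \<in> {1..d}" and "0 \<le> g" "0 \<le> c"
  shows "- ln (th i) \<le> lyap d c s g j th"
proof -
  have "- ln (th i) \<le> (\<Sum>i=1..d. - ln (th i))"
    using ThetaD[OF th] i by (intro member_le_sum) (auto simp: less_imp_le)
  moreover have "0 \<le> g * c * th j powr s" using assms by simp
  ultimately show ?thesis by (simp add: lyap_def sum_negf)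
qed

text \<open>With \<open>r = b / a\<close>, convexity of exp gives \<open>r powr s\<close> at most
  \<open>1 - s + s * r\<close>; divide by \<open>r\<close>. A jump from weight \<open>a\<close> to
  weight \<open>b\<close> that has probability of order \<open>a / b\<close> thus raises the power,
  on average, only by a fraction of order \<open>s\<close>.\<close>

lemma powr_rise_le:
  fixes a b s :: real
  assumes "0 < a" "a \<le> b" "0 \<le> s" "s \<le> 1"
  shows "a / b * (b powr s - a powr s) \<le> s * a powr s"
proof -
  have b: "0 < b" using assms by simp
  define r where "r = b / a"
  have r: "1 \<le> r" using assms by (simp add: r_def)
  have "r powr s = exp ((1 - s) *\<^sub>R 0 + s *\<^sub>R ln r)" using r by (simp add: powr_def)
  also have "\<dots> \<le> (1 - s) * exp 0 + s * exp (ln r)"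
    using assms by (intro convex_onD[OF exp_convex]) auto
  finally have "r powr s - 1 \<le> s * r"
    using assms r by simp
  then have *: "(r powr s - 1) / r \<le> s" using r by (simp add: field_simps)
  have "b powr s = a powr s * r powr s"
    using assms r by (simp add: r_def powr_divide)
  then have "a / b * (b powr s - a powr s) = a powr s * ((r powr s - 1) / r)"
    using assms b by (simp add: r_def field_simps)
  also have "\<dots> \<le> a powr s * s" using * by (intro mult_left_mono) auto
  finally show ?thesis by (simp add: mult.commute)
qed

text \<open>Here \<open>k\<close> is the current stratum, \<open>i\<close> a light one and
  \<open>r\<close> the law of the next stratum. Upward jumps add at most
  \<open>K * s * th k powr s\<close> each, the other jumps add nothing, and the jump to
  \<open>i\<close> brings the power down to at most \<open>e powr s\<close> with probability at
  least \<open>eta\<close>. For small \<open>s\<close> the gain from \<open>i\<close> wins.\<close>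

lemma powr_contraction:
  fixes th r :: "nat \<Rightarrow> real"
  assumes th: "th \<in> Theta d" and k: "k \<in> {1..d}" and i: "i \<in> {1..d}"
    and r_nonneg: "\<And>j. j \<in> {1..d} \<Longrightarrow> 0 \<le> r j" and r_sum: "(\<Sum>j=1..d. r j) = 1"
    and up: "\<And>j. j \<in> {1..d} \<Longrightarrow> th k < th j \<Longrightarrow> r j \<le> K * (th k / th j)"
    and down: "th i \<le> th k" "th i \<le> e" "eta \<le> r i"
    and K: "0 \<le> K" and s: "0 \<le> s" "s \<le> 1" "2 * K * real d * s \<le> eta"
  shows "(\<Sum>j=1..d. r j * th j powr s) \<le> (1 - eta/2) * th k powr s + eta * e powr s"
proof -
  define a where "a = th k"
  have a: "0 < a" using ThetaD[OF th k] by (simp add: a_def)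
  have eta: "0 \<le> eta" using s K by (smt (verit) mult_nonneg_nonneg of_nat_0_le_iff)
  \<comment> \<open>The allowance for upward jumps is granted to every \<open>j\<close>, where it is
    at least nonnegative; the gain is credited to \<open>i\<close> alone.\<close>
  have le: "r j * (th j powr s - a powr s) \<le> K * s * a powr s - (if j = i then eta * (a powr s - e powr s) else 0)"
    if j: "j \<in> {1..d}" for j
  proof (cases "j = i")
    case True
    have ie: "th i powr s \<le> e powr s" and ia: "th i powr s \<le> a powr s"
      using ThetaD[OF th i] down s by (auto simp: a_def intro!: powr_mono2)
    have "r i * (th i powr s - a powr s) \<le> eta * (th i powr s - a powr s)"
      using down(3) ia by (intro mult_right_mono_neg) auto
    also have "\<dots> \<le> eta * (e powr s - a powr s)"
      using eta ie by (intro mult_left_mono) auto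
    finally have "r i * (th i powr s - a powr s) \<le> eta * (e powr s - a powr s)" .
    moreover have "0 \<le> K * s * a powr s" using K s by simp
    ultimately show ?thesis using True by (simp add: algebra_simps)
  next
    case ji: False
    show ?thesis
    proof (cases "th j \<le> a")
      case True
      have "th j powr s \<le> a powr s"
        using ThetaD[OF th j] True s by (intro powr_mono2) auto
      then have "r j * (th j powr s - a powr s) \<le> 0"
        using r_nonneg[OF j] by (simp add: mult_nonneg_nonpos)
      also have "0 \<le> K * s * a powr s" using K s by simp
      finally show ?thesis using ji by simp
    next
      case False
      then have aj: "a \<le> th j" by simp
      have "r j * (th j powr s - a powr s) \<le> K * (a / th j) * (th j powr s - a powr s)"
        using up[OF j] False aj a s by (intro mult_right_mono) (auto simp: a_def intro!: powr_mono2)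
      also have "\<dots> = K * (a / th j * (th j powr s - a powr s))" by simp
      also have "\<dots> \<le> K * (s * a powr s)"
        using powr_rise_le[OF a aj s(1,2)] K by (rule mult_left_mono)
      finally show ?thesis using ji by simp
    qed
  qed
  have "(\<Sum>j=1..d. r j * th j powr s) - a powr s = (\<Sum>j=1..d. r j * (th j powr s - a powr s))"
    by (simp only: right_diff_distrib sum_subtractf sum_distrib_right[symmetric] r_sum mult_1_left)
  also have "\<dots> \<le> (\<Sum>j=1..d. K * s * a powr s - (if j = i then eta * (a powr s - e powr s) else 0))"
    using le by (intro sum_mono) blast
  also have "\<dots> = d * (K * s * a powr s) - eta * (a powr s - e powr s)"
    using i by (simp add: sum.distrib sum_subtractf)
  \<comment> \<open>The smallness of \<open>s\<close> enters here: the upward jumps together use up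
    at most half of the gain \<open>eta\<close>.\<close>
  also have "d * (K * s * a powr s) = (2 * K * real d * s) / 2 * a powr s" by simp
  also have "\<dots> \<le> eta / 2 * a powr s"
    using s(3) by (intro mult_right_mono) auto
  finally show ?thesis by (simp add: a_def algebra_simps)
qed

text \<open>Expanding the logarithms to first order, the increments \<open>u i\<close> sum to
  \<open>g * (1 - d * th j)\<close>, with a quadratic error of order \<open>g\<close> squared. The
  corrector grows at most by the factor \<open>1 + g\<close>, which also costs only second
  order.\<close>

lemma lyap_wl_step_le:
  assumes th: "th \<in> Theta d" and j: "j \<in> {1..d}" and g: "0 \<le> g" "g \<le> 1/2"
    and c: "0 \<le> c" and s: "0 \<le> s" "s \<le> 1"
  shows "lyap d c s g j (wl_step g j th)
    \<le> - (\<Sum>i=1..d. ln (th i)) + g * ((real d + c) * th j powr s - 1 + (2 * real d + c) * g)"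
proof -
  define u where "u i = g * ((if j = i then 1 else 0) - th j)" for i
  have tj: "0 < th j" "th j < 1" using ThetaD[OF th j] by auto
  have gt: "g * th j \<le> g * 1" using g tj by (intro mult_left_mono) auto
  have gt0: "0 \<le> g * th j" using g tj by simp
  have ug: "\<bar>u i\<bar> \<le> g" for i using gt gt0 g by (auto simp: u_def algebra_simps)
  have l: "- ln (1 + u i) \<le> - u i + 2 * g\<^sup>2" for i
  proof -
    \<comment> \<open>The quadratic bound on the logarithm requires the increment to be at most 1/2
      in absolute value.\<close>
    have "\<bar>ln (1 + u i) - u i\<bar> \<le> 2 * (u i)\<^sup>2"
      using ug[of i] g by (intro abs_ln_one_plus_x_minus_x_bound) auto
    also have "(u i)\<^sup>2 \<le> g\<^sup>2" using ug[of i] by (simp add: abs_le_square_iff[symmetric])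
    finally show ?thesis by (simp add: abs_le_iff)
  qed
  have ws: "wl_step g j th i = th i * (1 + u i)" for i by (simp add: wl_step_def u_def)
  have "- (\<Sum>i=1..d. ln (wl_step g j th i)) = (\<Sum>i=1..d. - ln (th i) + - ln (1 + u i))"
    unfolding sum_negf[symmetric]
  proof (rule sum.cong)
    fix i assume "i \<in> {1..d}"
    then have "0 < th i" using ThetaD[OF th] by blast
    moreover have "0 < 1 + u i" using ug[of i] g by auto
    ultimately show "- ln (wl_step g j th i) = - ln (th i) + - ln (1 + u i)"
      by (simp add: ws ln_mult)
  qed simp
  also have "\<dots> \<le> (\<Sum>i=1..d. - ln (th i) + (- u i + 2 * g\<^sup>2))"
    using l by (intro sum_mono add_left_mono) blast
  also have "\<dots> = - (\<Sum>i=1..d. ln (th i)) - (\<Sum>i=1..d. u i) + d * (2 * g\<^sup>2)"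
    by (simp add: sum.distrib sum_negf sum_subtractf)
  also have "(\<Sum>i=1..d. u i) = g * (1 - d * th j)"
    using j by (simp add: u_def sum_distrib_left[symmetric] sum_subtractf)
  finally have 1: "- (\<Sum>i=1..d. ln (wl_step g j th i))
    \<le> - (\<Sum>i=1..d. ln (th i)) - g * (1 - d * th j) + d * (2 * g\<^sup>2)" .
  \<comment> \<open>Weights lie below 1 and \<open>s\<close> is at most 1, so the linear term is
    absorbed into the power. The bound then depends on the new stratum only through
    \<open>th j powr s\<close>, the quantity that contracts.\<close>
  have jle: "th j \<le> th j powr s"
    using powr_mono'[of s 1 "th j"] tj s by simp
  have "wl_step g j th j powr s = th j powr s * (1 + u j) powr s"
    using tj ug[of j] g by (simp add: ws powr_mult)
  also have "\<dots> \<le> th j powr s * (1 + g)"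
  proof (rule mult_left_mono)
    have "(1 + u j) powr s \<le> (1 + g) powr s"
      using ug[of j] g s by (intro powr_mono2) auto
    also have "\<dots> \<le> (1 + g) powr 1" using g s by (intro powr_mono) auto
    finally show "(1 + u j) powr s \<le> 1 + g" using g by simp
  qed simp
  also have "\<dots> \<le> th j powr s + g"
  proof -
    have "th j powr s \<le> 1" using tj s by (simp add: powr_le1)
    then have "th j powr s * g \<le> 1 * g" using g by (intro mult_right_mono) auto
    then show ?thesis by (simp add: algebra_simps)
  qed
  finally have "g * c * wl_step g j th j powr s \<le> g * c * (th j powr s + g)"
    using g c by (intro mult_left_mono) auto
  moreover have "g * (d * th j) \<le> g * (d * th j powr s)"
    using jle g by (intro mult_left_mono) auto
  ultimately show ?thesis using 1 unfolding lyap_def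
    by (simp add: algebra_simps power2_eq_square)
qed

text \<open>Averaging the one-step bound over \<open>r\<close> leaves the mean of
  \<open>th j powr s\<close>, to which the contraction applies. The old energy carries the step
  \<open>g'\<close> and the new one \<open>g\<close>, so \<open>g \<le> g'\<close> gives the last
  inequality.\<close>

lemma lyap_drift:
  fixes th r :: "nat \<Rightarrow> real"
  assumes th: "th \<in> Theta d" and k: "k \<in> {1..d}" and i: "i \<in> {1..d}"
    and r_nonneg: "\<And>j. j \<in> {1..d} \<Longrightarrow> 0 \<le> r j" and r_sum: "(\<Sum>j=1..d. r j) = 1"
    and up: "\<And>j. j \<in> {1..d} \<Longrightarrow> th k < th j \<Longrightarrow> r j \<le> K * (th k / th j)"
    and down: "th i \<le> th k" "th i \<le> e" "eta \<le> r i"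
    and K: "0 \<le> K" and eta: "0 < eta"
    and s: "0 \<le> s" "s \<le> 1" "2 * K * real d * s \<le> eta"
    and c: "c = 2 * real d / eta"
    and e: "(real d + c) * eta * e powr s \<le> 1/2"
    and g: "0 \<le> g" "g \<le> g'" "g \<le> 1/2" "(2 * real d + c) * g \<le> 1/2"
  shows "(\<Sum>j=1..d. r j * lyap d c s g j (wl_step g j th)) \<le> lyap d c s g' k th"
proof -
  define W where "W = - (\<Sum>i=1..d. ln (th i))"
  define R where "R = (\<Sum>j=1..d. r j * th j powr s)"
  have c0: "0 \<le> c" using eta c by simp
  have "(\<Sum>j=1..d. r j * lyap d c s g j (wl_step g j th))
      \<le> (\<Sum>j=1..d. r j * (W + g * ((real d + c) * th j powr s - 1 + (2 * real d + c) * g)))"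
  proof (intro sum_mono mult_left_mono r_nonneg)
    fix j assume "j \<in> {1..d}"
    then show "lyap d c s g j (wl_step g j th) \<le> W + g * ((real d + c) * th j powr s - 1 + (2 * real d + c) * g)"
      unfolding W_def by (rule lyap_wl_step_le[OF th _ g(1,3) c0 s(1,2)])
  qed
  also have "\<dots> = (\<Sum>j=1..d. r j) * (W + g * ((2 * real d + c) * g - 1)) + g * (real d + c) * R"
    by (simp add: R_def sum_distrib_left sum_distrib_right algebra_simps sum.distrib sum_subtractf)
  also have "\<dots> = W + g * ((2 * real d + c) * g - 1 + (real d + c) * R)"
    unfolding r_sum by (simp add: algebra_simps)
  also have "\<dots> \<le> W + g * (c * th k powr s)"
  proof -
    have "R \<le> (1 - eta/2) * th k powr s + eta * e powr s"
      unfolding R_def by (rule powr_contraction[OF th k i r_nonneg r_sum up down K s])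
    then have "(real d + c) * R \<le> (real d + c) * ((1 - eta/2) * th k powr s + eta * e powr s)"
      using c0 by (intro mult_left_mono) auto
    also have "\<dots> = ((real d + c) * (1 - eta/2)) * th k powr s + (real d + c) * eta * e powr s"
      by (simp add: algebra_simps)
    \<comment> \<open>The value of \<open>c\<close> makes \<open>c * eta / 2\<close> equal to
      \<open>d\<close>: the contraction of the corrector pays exactly for the growth of the
      logarithmic part.\<close>
    also have "(real d + c) * (1 - eta/2) = c - d * eta / 2"
      using eta by (simp add: c field_simps)
    also have "(c - d * eta / 2) * th k powr s \<le> c * th k powr s"
      using eta by (intro mult_right_mono) auto
    \<comment> \<open>The drift \<open>-1\<close> is spent in two halves, one on the second-order
      error in \<open>g\<close> and one on the term with \<open>e powr s\<close>.\<close>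
    finally have "(2 * real d + c) * g - 1 + (real d + c) * R \<le> c * th k powr s"
      using e g by simp
    then show ?thesis using g by (intro add_left_mono mult_left_mono) auto
  qed
  also have "\<dots> \<le> W + g' * (c * th k powr s)"
    using g c0 by (intro add_left_mono mult_right_mono) auto
  finally show ?thesis by (simp add: lyap_def W_def)
qed

subsection \<open>Jump probabilities between strata\<close>

text \<open>The bounds from (A1) and (A2) are fixed as constants \<open>cp\<close>,
  \<open>Cp\<close>, \<open>cq\<close>, because the jump estimates are explicit in them and uniform
  in the state and the weights.\<close>

locale mh_strata =
  fixes lam :: "'a::polish_space measure"
    and p :: "'a \<Rightarrow> real" and d :: nat and I :: "'a \<Rightarrow> nat" and q :: "'a \<Rightarrow> 'a \<Rightarrow> real"
    and cp Cp cq :: real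
  assumes lam_borel: "sets lam = sets borel"
    and lam_sf: "sigma_finite_measure lam"
    and p_meas [measurable]: "p \<in> borel_measurable lam"
    and p_int: "integrable lam p"
    and d_ge: "d \<ge> 2"
    and I_meas [measurable]: "I \<in> measurable lam (count_space UNIV)"
    and I_range: "\<And>x. I x \<in> {1..d}"
    and cp: "0 < cp" "\<And>x. cp \<le> p x"
    and Cp: "\<And>x. p x \<le> Cp"
    and theta_star_pos: "\<And>i. i \<in> {1..d} \<Longrightarrow> theta_star lam p I i > 0"
    and q_meas: "(\<lambda>(x, y). q x y) \<in> borel_measurable (lam \<Otimes>\<^sub>M lam)"
    and q_nonneg: "\<And>x y. 0 \<le> q x y"
    and q_int: "\<And>x. integrable lam (q x)"
    and q_dens: "\<And>x. (LINT y|lam. q x y) = 1"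
    and cq: "0 < cq" "\<And>x y. cq \<le> q x y"
begin

section \<open>Strata, acceptance densities and jump probabilities\<close>

definition stratum :: "nat \<Rightarrow> 'a set" where
  "stratum j = {x \<in> space lam. I x = j}"

definition acc :: "(nat \<Rightarrow> real) \<Rightarrow> 'a \<Rightarrow> 'a \<Rightarrow> real" where
  "acc th x y = q x y * min 1 (p y / p x * (th (I x) / th (I y)))"

definition jump_prob :: "(nat \<Rightarrow> real) \<Rightarrow> 'a \<Rightarrow> nat \<Rightarrow> real" where
  "jump_prob th x j = MH_kernel lam q (pi_theta lam p I d th) x (stratum j)"

lemma stratum_sets [measurable]: "stratum j \<in> sets lam"
  unfolding stratum_def by measurable

lemma space_lam: "space lam = UNIV"
  using sets_eq_imp_space_eq[OF lam_borel] by simp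

lemma measurable_I: "I \<in> measurable lam (count_space {1..d})"
  using I_range by (subst measurable_count_space_eq2) (auto intro!: measurable_sets[OF I_meas])

lemma p_pos: "0 < p x"
  using cp(1) cp(2)[of x] by linarith

lemma Cp_pos: "0 < Cp" and cp_le_Cp: "cp \<le> Cp"
  using p_pos[of undefined] Cp[of undefined] cp(2)[of undefined] by linarith+

text \<open>The normalising constant of \<open>pi_theta\<close> is positive and cancels in the
  ratio, so the weights enter only through the quotient of the two strata involved.\<close>

lemma acc_eq:
  assumes th: "th \<in> Theta d"
  shows "q x y * min 1 (pi_theta lam p I d th y / pi_theta lam p I d th x) = acc th x y"
proof -
  have "0 < (\<Sum>i=1..d. theta_star lam p I i / th i)"
    using theta_star_pos ThetaD[OF th] d_ge by (intro sum_pos) auto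
  then show ?thesis
    using p_pos ThetaD[OF th I_range] by (simp add: acc_def pi_theta_def mult.commute)
qed

lemma jump_prob_eq:
  assumes th: "th \<in> Theta d"
  shows "jump_prob th x j = (LINT y:stratum j|lam. acc th x y)
    + (1 - (LINT y|lam. acc th x y)) * (if I x = j then 1 else 0)"
  by (simp add: jump_prob_def MH_kernel_def acc_eq[OF th] stratum_def space_lam indicator_def)

lemma acc_bounds:
  assumes th: "th \<in> Theta d"
  shows "0 \<le> acc th x y" "acc th x y \<le> q x y"
proof -
  have "0 \<le> p y / p x * (th (I x) / th (I y))"
    using p_pos[of x] p_pos[of y] ThetaD[OF th I_range[of x]] ThetaD[OF th I_range[of y]] by simp
  then have *: "0 \<le> min 1 (p y / p x * (th (I x) / th (I y)))" by simp
  then show "0 \<le> acc th x y" unfolding acc_def using q_nonneg by simp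
  have "q x y * min 1 (p y / p x * (th (I x) / th (I y))) \<le> q x y * 1"
    using q_nonneg by (intro mult_left_mono) auto
  then show "acc th x y \<le> q x y" by (simp add: acc_def)
qed

lemma integrable_acc:
  assumes th: "th \<in> Theta d"
  shows "integrable lam (acc th x)"
proof (rule Bochner_Integration.integrable_bound[OF q_int[of x]])
  have [measurable]: "q x \<in> borel_measurable lam" using q_int[of x] by auto
  show "acc th x \<in> borel_measurable lam" unfolding acc_def by measurable
qed (use acc_bounds[OF th] q_nonneg in auto)

lemma set_integrable_acc:
  "th \<in> Theta d \<Longrightarrow> set_integrable lam (stratum j) (acc th x)"
  using integrable_acc stratum_sets unfolding set_integrable_def
  by (intro integrable_mult_indicator) auto

lemma set_integral_acc_nonneg:
  assumes th: "th \<in> Theta d"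
  shows "0 \<le> (LINT y:stratum j|lam. acc th x y)"
  using acc_bounds[OF th] unfolding set_lebesgue_integral_def
  by (intro integral_nonneg_AE AE_I2) (auto intro!: mult_nonneg_nonneg)

lemma integral_acc_le_1:
  assumes th: "th \<in> Theta d"
  shows "(LINT y|lam. acc th x y) \<le> 1"
  using integral_mono[OF integrable_acc[OF th, of x] q_int[of x]] acc_bounds[OF th] q_dens[of x]
  by simp

lemma sum_set_integral_strata:
  fixes f :: "'a \<Rightarrow> real"
  assumes f: "integrable lam f"
  shows "(\<Sum>j=1..d. LINT y:stratum j|lam. f y) = (LINT y|lam. f y)"
proof -
  have "(\<Sum>j=1..d. LINT y:stratum j|lam. f y)
      = (LINT y|lam. (\<Sum>j=1..d. indicator (stratum j) y *\<^sub>R f y))"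
    unfolding set_lebesgue_integral_def
    by (rule Bochner_Integration.integral_sum[symmetric])
      (use integrable_mult_indicator[OF stratum_sets f] in auto)
  also have "\<dots> = (LINT y|lam. f y)"
  proof (rule Bochner_Integration.integral_cong)
    fix y
    have "(\<Sum>j=1..d. indicator (stratum j) y *\<^sub>R f y) = (\<Sum>j=1..d. if j = I y then f y else 0)"
      by (rule sum.cong) (auto simp: stratum_def space_lam)
    also have "\<dots> = f y" using I_range[of y] by (simp only: sum.delta finite_atLeastAtMost) simp
    finally show "(\<Sum>j=1..d. indicator (stratum j) y *\<^sub>R f y) = f y" .
  qed simp
  finally show ?thesis .
qed

section \<open>Bounds on the jump probabilities\<close>

lemma jump_prob_nonneg:
  assumes th: "th \<in> Theta d"
  shows "0 \<le> jump_prob th x j"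
  using set_integral_acc_nonneg[OF th, of j x] integral_acc_le_1[OF th, of x]
  by (auto simp: jump_prob_eq[OF th])

lemma sum_jump_prob:
  assumes th: "th \<in> Theta d"
  shows "(\<Sum>j=1..d. jump_prob th x j) = 1"
  unfolding jump_prob_eq[OF th] sum.distrib sum_set_integral_strata[OF integrable_acc[OF th]]
    sum_distrib_left[symmetric]
  using I_range[of x] by simp

text \<open>The strict inequality rules out \<open>j = I x\<close>, so rejection does not
  contribute. The acceptance probability is at most the ratio of target densities, and the proposal
  density has mass 1.\<close>

lemma jump_prob_up:
  assumes th: "th \<in> Theta d" and j: "j \<in> {1..d}" and lt: "th (I x) < th j"
  shows "jump_prob th x j \<le> Cp / cp * (th (I x) / th j)"
proof -
  let ?K = "Cp / cp * (th (I x) / th j)"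
  have tx: "0 < th (I x)" and tj: "0 < th j" using ThetaD[OF th] I_range j by auto
  have K: "0 \<le> ?K" using tx tj Cp_pos cp by simp
  have "jump_prob th x j = (LINT y:stratum j|lam. acc th x y)"
    using lt by (auto simp: jump_prob_eq[OF th])
  also have "\<dots> \<le> (LINT y|lam. ?K * q x y)"
    unfolding set_lebesgue_integral_def
  proof (rule integral_mono)
    show "integrable lam (\<lambda>y. indicator (stratum j) y *\<^sub>R acc th x y)"
      using set_integrable_acc[OF th] unfolding set_integrable_def .
    show "integrable lam (\<lambda>y. ?K * q x y)" using q_int by simp
    fix y
    show "indicator (stratum j) y *\<^sub>R acc th x y \<le> ?K * q x y"
    proof (cases "I y = j")
      case True
      have "p y / p x \<le> Cp / cp"
        using cp Cp p_pos Cp_pos by (intro frac_le) (auto intro: less_imp_le)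
      then have "p y / p x * (th (I x) / th j) \<le> ?K"
        using tx tj by (intro mult_right_mono) auto
      then have "q x y * min 1 (p y / p x * (th (I x) / th j)) \<le> q x y * ?K"
        using q_nonneg by (intro mult_left_mono) auto
      then show ?thesis using True by (simp add: acc_def stratum_def space_lam mult.commute)
    next
      case False
      have "0 \<le> ?K * q x y" using K q_nonneg[of x y] by (rule mult_nonneg_nonneg)
      with False show ?thesis by (simp add: stratum_def)
    qed
  qed
  also have "\<dots> = ?K" using q_dens by simp
  finally show ?thesis .
qed

text \<open>The integrable \<open>p\<close> is bounded below by \<open>cp\<close>, so Markov's
  inequality bounds the mass of \<open>lam\<close>, which is assumed only sigma-finite.\<close>

lemma emeasure_stratum_finite: "emeasure lam (stratum j) < \<infinity>"
proof -
  have "emeasure lam (stratum j) \<le> emeasure lam {x \<in> space lam. p x \<ge> cp}"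
    using cp(2) by (intro emeasure_mono) (simp_all add: space_lam[symmetric] stratum_def)
  also have "\<dots> \<le> ennreal ((1 / cp) * (LINT x|lam. p x))"
    using p_pos cp(1) by (intro integral_Markov_inequality p_int) (auto intro: less_imp_le)
  also have "\<dots> < \<infinity>" by simp
  finally show ?thesis .
qed

text \<open>A null stratum would have \<open>theta_star\<close> equal to 0. Finiteness matters
  because \<open>measure\<close> is 0 also on sets of infinite mass.\<close>

lemma measure_stratum_pos:
  assumes "j \<in> {1..d}"
  shows "0 < measure lam (stratum j)"
proof (rule ccontr)
  assume "\<not> ?thesis"
  then have "measure lam (stratum j) = 0"
    using measure_nonneg[of lam "stratum j"] by linarith
  then have "emeasure lam (stratum j) = 0"
    using emeasure_stratum_finite[of j] by (simp add: emeasure_eq_ennreal_measure)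
  then have "stratum j \<in> null_sets lam" by (auto simp: null_sets_def)
  then have "AE x in lam. indicator (stratum j) x *\<^sub>R p x = 0"
    by (rule AE_I') (auto simp: indicator_def)
  then have "theta_star lam p I j = 0"
    unfolding theta_star_def set_lebesgue_integral_def stratum_def[symmetric]
    by (rule integral_eq_zero_AE)
  with theta_star_pos[OF assms] show False by simp
qed

text \<open>Towards a stratum of no larger weight the weight quotient is at least 1, so only the
  bounds on \<open>p\<close> and \<open>q\<close> remain. If \<open>j = I x\<close>, rejection only
  adds mass.\<close>

lemma jump_prob_down:
  assumes th: "th \<in> Theta d" and j: "j \<in> {1..d}" and le: "th j \<le> th (I x)"
  shows "cq * (cp / Cp) * measure lam (stratum j) \<le> jump_prob th x j"
proof -
  let ?K = "cq * (cp / Cp)"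
  have tj: "0 < th j" using ThetaD[OF th j] by simp
  have fin: "integrable lam (\<lambda>y. indicator (stratum j) y * ?K)"
    using emeasure_stratum_finite by (intro integrable_mult_left integrable_real_indicator) auto
  have "?K * measure lam (stratum j) = (LINT y|lam. indicator (stratum j) y * ?K)"
    by (simp add: space_lam)
  also have "\<dots> \<le> (LINT y:stratum j|lam. acc th x y)"
    unfolding set_lebesgue_integral_def
  proof (rule integral_mono[OF fin])
    show "integrable lam (\<lambda>y. indicator (stratum j) y *\<^sub>R acc th x y)"
      using set_integrable_acc[OF th] unfolding set_integrable_def .
    fix y
    show "indicator (stratum j) y * ?K \<le> indicator (stratum j) y *\<^sub>R acc th x y"
    proof (cases "I y = j")
      case True
      have "cp / Cp \<le> p y / p x"
        using cp Cp p_pos Cp_pos by (intro frac_le) (auto intro: less_imp_le)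
      moreover have "p y / p x * 1 \<le> p y / p x * (th (I x) / th j)"
        using tj le p_pos[of x] p_pos[of y] by (intro mult_left_mono) auto
      \<comment> \<open>As \<open>cp / Cp\<close> is at most 1, the bound survives the truncation at
        1.\<close>
      ultimately have "cp / Cp \<le> min 1 (p y / p x * (th (I x) / th j))"
        using cp_le_Cp Cp_pos by simp
      then have "?K \<le> q x y * min 1 (p y / p x * (th (I x) / th j))"
        using cq(2)[of x y] cq(1) cp(1) Cp_pos q_nonneg by (intro mult_mono) auto
      then show ?thesis using True by (simp add: acc_def stratum_def space_lam)
    qed (simp add: stratum_def)
  qed
  also have "\<dots> \<le> jump_prob th x j"
    using integral_acc_le_1[OF th, of x] by (simp add: jump_prob_eq[OF th])
  finally show ?thesis .
qed

text \<open>State and weights are both random here. A weight at a random index is measurable because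
  the index takes finitely many values, and sigma-finiteness of \<open>lam\<close> gives
  measurability of the parameter integrals.\<close>

lemma measurable_jump_prob:
  assumes Y: "Y \<in> measurable F lam" and T: "\<And>i. i \<in> {1..d} \<Longrightarrow> (\<lambda>w. T w i) \<in> borel_measurable F"
    and th: "\<And>w. w \<in> space F \<Longrightarrow> T w \<in> Theta d"
  shows "(\<lambda>w. jump_prob (T w) (Y w) j) \<in> borel_measurable F"
proof -
  interpret sigma_finite_measure lam by (rule lam_sf)
  have [measurable]: "(\<lambda>z. q (fst z) (snd z)) \<in> borel_measurable (lam \<Otimes>\<^sub>M lam)"
    using q_meas by (simp add: case_prod_beta')
  note [measurable] = Y
  have T_Y [measurable]: "(\<lambda>w. T w (I (Y w))) \<in> borel_measurable F"
    by (rule measurable_compose_countable'[OF T measurable_compose[OF Y measurable_I]]) simp_all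
  have T_y [measurable]: "(\<lambda>z. T (fst z) (I (snd z))) \<in> borel_measurable (F \<Otimes>\<^sub>M lam)"
  proof (rule measurable_compose_countable'[where f = "\<lambda>i z. T (fst z) i"
        and g = "\<lambda>z. I (snd z)" and I = "{1..d}"])
    show "(\<lambda>z. T (fst z) i) \<in> borel_measurable (F \<Otimes>\<^sub>M lam)" if "i \<in> {1..d}" for i
      using measurable_compose[OF measurable_fst T[OF that]] .
    show "(\<lambda>z. I (snd z)) \<in> measurable (F \<Otimes>\<^sub>M lam) (count_space {1..d})"
      using measurable_compose[OF measurable_snd measurable_I] .
  qed simp
  have qY [measurable]: "(\<lambda>z. q (Y (fst z)) (snd z)) \<in> borel_measurable (F \<Otimes>\<^sub>M lam)"
    using measurable_compose[of "\<lambda>z. (Y (fst z), snd z)" _ "lam \<Otimes>\<^sub>M lam" "\<lambda>z. q (fst z) (snd z)"]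
    by simp
  have a [measurable]: "(\<lambda>z. acc (T (fst z)) (Y (fst z)) (snd z)) \<in> borel_measurable (F \<Otimes>\<^sub>M lam)"
    unfolding acc_def by measurable
  have 1: "(\<lambda>w. LINT y:stratum j|lam. acc (T w) (Y w) y) \<in> borel_measurable F"
    unfolding set_lebesgue_integral_def
    by (rule borel_measurable_lebesgue_integral) (simp add: case_prod_beta')
  have 2: "(\<lambda>w. LINT y|lam. acc (T w) (Y w) y) \<in> borel_measurable F"
    by (rule borel_measurable_lebesgue_integral) (simp add: case_prod_beta')
  have 3: "(\<lambda>w. if I (Y w) = j then 1 else 0 :: real) \<in> borel_measurable F"
    by measurable
  have "(\<lambda>w. (LINT y:stratum j|lam. acc (T w) (Y w) y)
      + (1 - (LINT y|lam. acc (T w) (Y w) y)) * (if I (Y w) = j then 1 else 0)) \<in> borel_measurable F"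
    using 1 2 3 by measurable
  then show ?thesis
    by (subst measurable_cong[OF jump_prob_eq[OF th]])
qed

end
subsection \<open>The supermartingale argument\<close>

text \<open>Fatou's lemma takes the place of supermartingale convergence: the liminf of the
  restricted variables has finite integral, hence is finite almost surely, while divergence on all
  \<open>G n\<close> would make it infinite.\<close>

lemma AE_not_at_top_if_bounded_integrals:
  fixes V :: "nat \<Rightarrow> 'b \<Rightarrow> real"
  assumes V: "\<And>n. V n \<in> borel_measurable M" and G: "\<And>n. G n \<in> sets M"
    and bound: "\<And>n. (\<integral>\<^sup>+w\<in>G n. ennreal (V n w) \<partial>M) \<le> ennreal k"
  shows "AE w in M. (\<forall>n. w \<in> G n) \<longrightarrow> \<not> filterlim (\<lambda>n. V n w) at_top sequentially"
proof -
  note [measurable] = V G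
  let ?f = "\<lambda>n w. ennreal (V n w) * indicator (G n) w"
  have "(\<integral>\<^sup>+w. liminf (\<lambda>n. ?f n w) \<partial>M) \<le> liminf (\<lambda>n. \<integral>\<^sup>+w. ?f n w \<partial>M)"
    by (rule nn_integral_liminf) measurable
  also have "\<dots> \<le> limsup (\<lambda>n. \<integral>\<^sup>+w. ?f n w \<partial>M)"
    by (rule Liminf_le_Limsup) simp
  also have "\<dots> \<le> ennreal k"
    using bound by (intro Limsup_bounded) auto
  finally have "(\<integral>\<^sup>+w. liminf (\<lambda>n. ?f n w) \<partial>M) \<noteq> \<infinity>"
    by (auto simp: top_unique)
  then have "AE w in M. liminf (\<lambda>n. ?f n w) \<noteq> \<infinity>"
    by (intro nn_integral_noteq_infinite) measurable
  then show ?thesis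
  proof eventually_elim
    case (elim w)
    show ?case
    proof (intro impI notI)
      assume G: "\<forall>n. w \<in> G n" and top: "filterlim (\<lambda>n. V n w) at_top sequentially"
      obtain r where r: "0 \<le> r" "liminf (\<lambda>n. ?f n w) = ennreal r"
        using elim by (cases "liminf (\<lambda>n. ?f n w)") auto
      have "eventually (\<lambda>n. r + 1 \<le> V n w) sequentially"
        using top by (simp add: filterlim_at_top)
      then have "eventually (\<lambda>n. ennreal (r + 1) \<le> ?f n w) sequentially"
        by eventually_elim (use G in \<open>auto intro: ennreal_leI\<close>)
      then have "ennreal (r + 1) \<le> liminf (\<lambda>n. ?f n w)"
        by (rule Liminf_bounded)
      with r show False by (simp add: ennreal_le_iff)
    qed
  qed
qed

locale wl_process = mh_strata lam p d I q cp Cp cq + prob_space M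
  for lam :: "'a::polish_space measure" and p d I q cp Cp cq and M :: "'b measure" +
  fixes gam :: "nat \<Rightarrow> real"
    and X :: "nat \<Rightarrow> 'b \<Rightarrow> 'a"
    and th0 :: "'b \<Rightarrow> nat \<Rightarrow> real"
  assumes gam_range: "\<And>n. n \<ge> 1 \<Longrightarrow> 0 \<le> gam n \<and> gam n < 1"
    and gam_mono: "\<And>n. n \<ge> 1 \<Longrightarrow> gam (Suc n) \<le> gam n"
    and gam_lim: "gam \<longlonglongrightarrow> 0"
    and X_meas: "\<And>n. X n \<in> measurable M lam"
    and th0_meas: "\<And>i. (\<lambda>w. th0 w i) \<in> borel_measurable M"
    and th0_Theta: "\<And>w. w \<in> space M \<Longrightarrow> th0 w \<in> Theta d"
    and X_trans: "\<And>n B A. B \<in> sets lam \<Longrightarrow>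
         A \<in> sigma_sets (space M) (F_gen M d X th0 n) \<Longrightarrow>
         measure M (A \<inter> (X (Suc n) -` B \<inter> space M)) =
         (LINT w:A|M. MH_kernel lam q
              (pi_theta lam p I d (theta_seq gam I (th0 w) (\<lambda>k. X k w) n))
              (X n w) B)"
begin

section \<open>The weight process, its filtration and the energy along a path\<close>

definition TH :: "nat \<Rightarrow> 'b \<Rightarrow> nat \<Rightarrow> real" where
  "TH n w = theta_seq gam I (th0 w) (\<lambda>k. X k w) n"

definition Fil :: "nat \<Rightarrow> 'b measure" where
  "Fil n = sigma (space M) (F_gen M d X th0 n)"

definition V :: "real \<Rightarrow> real \<Rightarrow> nat \<Rightarrow> 'b \<Rightarrow> real" where
  "V c s n w = lyap d c s (gam n) (I (X n w)) (TH n w)"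

lemma F_gen_sub: "F_gen M d X th0 n \<subseteq> sets M"
  using X_meas th0_meas measurable_sets[OF X_meas] measurable_sets[OF th0_meas]
  by (auto simp: F_gen_def lam_borel)

lemma F_gen_Pow: "F_gen M d X th0 n \<subseteq> Pow (space M)"
  using F_gen_sub sets.space_closed by blast

lemma space_Fil [simp]: "space (Fil n) = space M"
  unfolding Fil_def using F_gen_Pow by (rule space_measure_of)

lemma sets_Fil: "sets (Fil n) = sigma_sets (space M) (F_gen M d X th0 n)"
  unfolding Fil_def using F_gen_Pow by (rule sets_measure_of)

lemma subalgebra_Fil: "subalgebra M (Fil n)"
  unfolding subalgebra_def sets_Fil using sets.sigma_sets_subset[OF F_gen_sub] by simp

lemma measurable_X_Fil: "j \<le> n \<Longrightarrow> X j \<in> measurable (Fil n) lam"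
  using measurable_space[OF X_meas]
  by (intro measurableI) (auto simp: sets_Fil lam_borel F_gen_def intro!: sigma_sets.Basic)

lemma measurable_I_X_Fil:
  assumes "j \<le> n"
  shows "(\<lambda>w. I (X j w)) \<in> measurable (Fil n) (count_space {1..d})"
  by (rule measurable_compose[OF measurable_X_Fil[OF assms] measurable_I])

lemma TH_Suc: "TH (Suc n) w = wl_step (gam (Suc n)) (I (X (Suc n) w)) (TH n w)"
  by (simp only: TH_def theta_seq_Suc_eq_wl_step)

lemma TH_Theta:
  assumes "w \<in> space M"
  shows "TH n w \<in> Theta d"
proof (induction n)
  case 0
  then show ?case using th0_Theta[OF assms] by (simp add: TH_def)
next
  case (Suc n)
  show ?case unfolding TH_Suc
    using gam_range[of "Suc n"] by (intro wl_step_in_Theta Suc I_range d_ge) auto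
qed

text \<open>The update of one coordinate also reads the coordinate of the visited stratum, a random
  index with finitely many values; hence the induction runs over all coordinates at once.\<close>

lemma measurable_TH_Fil:
  assumes "i \<in> {1..d}" "n \<le> m"
  shows "(\<lambda>w. TH n w i) \<in> borel_measurable (Fil m)"
  using assms
proof (induction n arbitrary: i)
  case 0
  then show ?case
    by (intro measurableI) (auto simp: TH_def sets_Fil F_gen_def intro!: sigma_sets.Basic)
next
  case (Suc n)
  have [measurable]: "(\<lambda>w. I (X (Suc n) w)) \<in> measurable (Fil m) (count_space UNIV)"
    using measurable_compose[OF measurable_X_Fil I_meas] Suc.prems by blast
  have [measurable]: "(\<lambda>w. TH n w i) \<in> borel_measurable (Fil m)"
    using Suc by simp
  have [measurable]: "(\<lambda>w. TH n w (I (X (Suc n) w))) \<in> borel_measurable (Fil m)"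
    by (rule measurable_compose_countable'[where f = "\<lambda>i w. TH n w i"
          and g = "\<lambda>w. I (X (Suc n) w)" and I = "{1..d}"])
      (use Suc measurable_I_X_Fil in auto)
  show ?case unfolding TH_Suc wl_step_def by measurable
qed

lemma measurable_V_Fil:
  assumes "n \<le> m"
  shows "V c s n \<in> borel_measurable (Fil m)"
proof -
  have [measurable]: "(\<lambda>w. TH n w (I (X n w))) \<in> borel_measurable (Fil m)"
    by (rule measurable_compose_countable'[where f = "\<lambda>i w. TH n w i"
          and g = "\<lambda>w. I (X n w)" and I = "{1..d}"])
      (use measurable_TH_Fil measurable_I_X_Fil assms in auto)
  have [measurable]: "(\<lambda>w. \<Sum>i=1..d. ln (TH n w i)) \<in> borel_measurable (Fil m)"
    using measurable_TH_Fil[OF _ assms] by (intro borel_measurable_sum borel_measurable_ln) auto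
  show ?thesis unfolding V_def[abs_def] lyap_def by measurable
qed

section \<open>Conditional law of the next stratum and drift in expectation\<close>

lemma measurable_jump_prob_Fil:
  "(\<lambda>w. jump_prob (TH n w) (X n w) j) \<in> borel_measurable (Fil n)"
  by (rule measurable_jump_prob) (use measurable_X_Fil measurable_TH_Fil TH_Theta in auto)

lemma jump_prob_le_1:
  assumes "th \<in> Theta d" "j \<in> {1..d}"
  shows "jump_prob th x j \<le> 1"
  using member_le_sum[of j "{1..d}" "jump_prob th x"] jump_prob_nonneg[OF assms(1)] assms
    sum_jump_prob[OF assms(1), of x] by auto

text \<open>The transition assumption \<open>X_trans\<close>, tested on events of
  \<open>Fil n\<close>, says that the jump probability is a version of the conditional probability
  of the next stratum. A factor \<open>f\<close> known at time \<open>n\<close> can then be carried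
  along.\<close>

lemma nn_integral_jump:
  assumes f: "f \<in> borel_measurable (Fil n)" and j: "j \<in> {1..d}"
  shows "(\<integral>\<^sup>+w. f w * indicator (X (Suc n) -` stratum j \<inter> space M) w \<partial>M)
    = (\<integral>\<^sup>+w. f w * ennreal (jump_prob (TH n w) (X n w) j) \<partial>M)"
proof -
  interpret S: finite_measure_subalgebra M "Fil n"
    by unfold_locales (rule subalgebra_Fil)
  let ?E = "X (Suc n) -` stratum j \<inter> space M"
  let ?r = "\<lambda>w. jump_prob (TH n w) (X n w) j"
  have E [measurable]: "?E \<in> sets M" using X_meas stratum_sets by (rule measurable_sets)
  note rF [measurable] = measurable_jump_prob_Fil[of n j]
  have rM [measurable]: "?r \<in> borel_measurable M"
    by (rule measurable_from_subalg[OF subalgebra_Fil rF])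
  have r: "0 \<le> ?r w" "?r w \<le> 1" if "w \<in> space M" for w
    using jump_prob_nonneg jump_prob_le_1 TH_Theta[OF that] j by auto
  have "AE w in M. ennreal (?r w) = nn_cond_exp M (Fil n) (indicator ?E) w"
  proof (rule S.nn_cond_exp_charact)
    fix A assume A: "A \<in> sets (Fil n)"
    then have AM [measurable]: "A \<in> sets M" using subalgebra_Fil by (auto simp: subalgebra_def)
    have "(\<integral>\<^sup>+w\<in>A. indicator ?E w \<partial>M) = (\<integral>\<^sup>+w. indicator (A \<inter> ?E) w \<partial>M)"
      by (rule nn_integral_cong) (auto simp: indicator_def)
    also have "\<dots> = emeasure M (A \<inter> ?E)"
      by (rule nn_integral_indicator) measurable
    also have "\<dots> = ennreal (LINT w:A|M. ?r w)"
      using X_trans[OF stratum_sets A[unfolded sets_Fil], of j]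
      by (simp add: emeasure_eq_measure jump_prob_def TH_def)
    also have "\<dots> = (\<integral>\<^sup>+w. ennreal (indicator A w *\<^sub>R ?r w) \<partial>M)"
      unfolding set_lebesgue_integral_def
    proof (rule nn_integral_eq_integral[symmetric])
      show "integrable M (\<lambda>w. indicator A w *\<^sub>R ?r w)"
        using r by (intro integrable_const_bound[where B = 1]) (auto simp: indicator_def)
      show "AE w in M. 0 \<le> indicator A w *\<^sub>R ?r w"
        using r by (auto simp: indicator_def)
    qed
    also have "\<dots> = (\<integral>\<^sup>+w\<in>A. ennreal (?r w) \<partial>M)"
      by (rule nn_integral_cong) (auto simp: indicator_def)
    finally show "(\<integral>\<^sup>+w\<in>A. indicator ?E w \<partial>M) = (\<integral>\<^sup>+w\<in>A. ennreal (?r w) \<partial>M)" .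
  qed measurable
  then have "(\<integral>\<^sup>+w. f w * ennreal (?r w) \<partial>M)
      = (\<integral>\<^sup>+w. f w * nn_cond_exp M (Fil n) (indicator ?E) w \<partial>M)"
    by (intro nn_integral_cong_AE) auto
  also have "\<dots> = (\<integral>\<^sup>+w. f w * indicator ?E w \<partial>M)"
    using f by (rule S.nn_cond_exp_intg) measurable
  finally show ?thesis by simp
qed

text \<open>Splitting by the next stratum and conditioning on \<open>Fil n\<close> reduces the claim
  to \<open>lyap_drift\<close> at each point of \<open>G\<close>.\<close>

lemma nn_integral_V_Suc_le:
  assumes n: "n \<ge> 1" and G: "G \<in> sets (Fil n)"
    and small: "\<And>w. w \<in> G \<Longrightarrow> \<exists>i\<in>{1..d}. TH n w i \<le> e"
    and eta: "0 < eta" "\<And>j. j \<in> {1..d} \<Longrightarrow> eta \<le> cq * (cp / Cp) * measure lam (stratum j)"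
    and s: "0 \<le> s" "s \<le> 1" "2 * (Cp / cp) * real d * s \<le> eta"
    and c: "c = 2 * real d / eta"
    and e: "(real d + c) * eta * e powr s \<le> 1/2"
    and g: "gam (Suc n) \<le> 1/2" "(2 * real d + c) * gam (Suc n) \<le> 1/2"
  shows "(\<integral>\<^sup>+w\<in>G. ennreal (V c s (Suc n) w) \<partial>M) \<le> (\<integral>\<^sup>+w\<in>G. ennreal (V c s n w) \<partial>M)"
proof -
  let ?E = "\<lambda>j. X (Suc n) -` stratum j \<inter> space M"
  let ?r = "\<lambda>j w. jump_prob (TH n w) (X n w) j"
  \<comment> \<open>\<open>psi j\<close> is the energy at time \<open>Suc n\<close> if stratum
    \<open>j\<close> is visited then; it depends only on the past.\<close>
  define psi where "psi j w = lyap d c s (gam (Suc n)) j (wl_step (gam (Suc n)) j (TH n w))" for j w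
  have c0: "0 \<le> c" using eta(1) c by simp
  have g0: "0 \<le> gam (Suc n)" "gam (Suc n) < 1" using gam_range[of "Suc n"] by auto
  have GM: "G \<subseteq> space M" using sets.sets_into_space[OF G] by simp
  have psi_nonneg: "0 \<le> psi j w" if "w \<in> space M" "j \<in> {1..d}" for j w
    unfolding psi_def
    by (intro lyap_nonneg wl_step_in_Theta TH_Theta that g0 d_ge c0)
  have psi_meas: "psi j \<in> borel_measurable (Fil n)" if j: "j \<in> {1..d}" for j
  proof -
    have w: "(\<lambda>w. wl_step (gam (Suc n)) j (TH n w) i) \<in> borel_measurable (Fil n)"
      if i: "i \<in> {1..d}" for i
    proof -
      note [measurable] = measurable_TH_Fil[OF i order_refl] measurable_TH_Fil[OF j order_refl]
      show ?thesis unfolding wl_step_def by measurable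
    qed
    note [measurable] = w[OF j]
    have [measurable]: "(\<lambda>u. \<Sum>i=1..d. ln (wl_step (gam (Suc n)) j (TH n u) i)) \<in> borel_measurable (Fil n)"
      using w by (intro borel_measurable_sum borel_measurable_ln) auto
    show ?thesis unfolding psi_def[abs_def] lyap_def by measurable
  qed
  have fM: "(\<lambda>w. ennreal (psi j w) * indicator G w) \<in> borel_measurable (Fil n)" if "j \<in> {1..d}" for j
    using psi_meas[OF that] G by measurable
  note toM = measurable_from_subalg[OF subalgebra_Fil]
  have "(\<integral>\<^sup>+w\<in>G. ennreal (V c s (Suc n) w) \<partial>M)
      = (\<integral>\<^sup>+w. (\<Sum>j=1..d. ennreal (psi j w) * indicator G w * indicator (?E j) w) \<partial>M)"
  proof (rule nn_integral_cong)
    fix w assume w: "w \<in> space M"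
    have "(\<Sum>j=1..d. ennreal (psi j w) * indicator G w * indicator (?E j) w)
        = (\<Sum>j=1..d. if j = I (X (Suc n) w) then ennreal (psi j w) * indicator G w else 0)"
      using w by (intro sum.cong) (auto simp: stratum_def space_lam)
    also have "\<dots> = ennreal (psi (I (X (Suc n) w)) w) * indicator G w"
      using I_range[of "X (Suc n) w"] by (simp only: sum.delta finite_atLeastAtMost) simp
    also have "psi (I (X (Suc n) w)) w = V c s (Suc n) w"
      by (simp add: psi_def V_def TH_Suc)
    finally show "ennreal (V c s (Suc n) w) * indicator G w
        = (\<Sum>j=1..d. ennreal (psi j w) * indicator G w * indicator (?E j) w)" ..
  qed
  also have "\<dots> = (\<Sum>j=1..d. \<integral>\<^sup>+w. ennreal (psi j w) * indicator G w * indicator (?E j) w \<partial>M)"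
    using toM[OF fM] measurable_sets[OF X_meas stratum_sets]
    by (intro nn_integral_sum) (auto intro!: borel_measurable_times_ennreal borel_measurable_indicator)
  also have "\<dots> = (\<Sum>j=1..d. \<integral>\<^sup>+w. ennreal (psi j w) * indicator G w * ennreal (?r j w) \<partial>M)"
    by (intro sum.cong nn_integral_jump fM) auto
  also have "\<dots> = (\<integral>\<^sup>+w. (\<Sum>j=1..d. ennreal (psi j w) * indicator G w * ennreal (?r j w)) \<partial>M)"
    by (rule nn_integral_sum[symmetric], rule borel_measurable_times_ennreal[OF toM[OF fM]])
      (use toM[OF measurable_jump_prob_Fil] in auto)
  also have "\<dots> \<le> (\<integral>\<^sup>+w\<in>G. ennreal (V c s n w) \<partial>M)"
  proof (rule nn_integral_mono)
    fix w assume w: "w \<in> space M"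
    show "(\<Sum>j=1..d. ennreal (psi j w) * indicator G w * ennreal (?r j w))
        \<le> ennreal (V c s n w) * indicator G w"
    proof (cases "w \<in> G")
      case True
      note th = TH_Theta[OF w, of n]
      note r0 = jump_prob_nonneg[OF th, of "X n w"]
      have fin: "finite (TH n w ` {1..d})" "TH n w ` {1..d} \<noteq> {}" using d_ge by auto
      \<comment> \<open>A lightest stratum serves as the target of the downward jump: it is no
        heavier than the current one and, on \<open>G\<close>, has weight at most
        \<open>e\<close>.\<close>
      obtain i where i: "i \<in> {1..d}" "TH n w i = Min (TH n w ` {1..d})"
        using Min_in[OF fin] by (metis (no_types, lifting) imageE)
      have le: "TH n w i \<le> TH n w j" if "j \<in> {1..d}" for j
        using i(2) fin that by simp
      obtain i' where i': "i' \<in> {1..d}" "TH n w i' \<le> e" using small[OF True] by blast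
      have "(\<Sum>j=1..d. ennreal (psi j w) * indicator G w * ennreal (?r j w))
          = ennreal (\<Sum>j=1..d. ?r j w * psi j w)"
      proof -
        have "(\<Sum>j=1..d. ennreal (psi j w) * indicator G w * ennreal (?r j w))
          = (\<Sum>j=1..d. ennreal (?r j w * psi j w))"
          using True psi_nonneg[OF w] r0
          by (intro sum.cong) (auto simp: ennreal_mult mult.commute)
        also have "\<dots> = ennreal (\<Sum>j=1..d. ?r j w * psi j w)"
          using psi_nonneg[OF w] r0 by (intro sum_ennreal) auto
        finally show ?thesis .
      qed
      also have "\<dots> \<le> ennreal (V c s n w)"
        unfolding psi_def V_def
      proof (intro ennreal_leI lyap_drift[where e = e and eta = eta and K = "Cp / cp", OF th I_range i(1) r0])
        show "(\<Sum>j=1..d. ?r j w) = 1" by (rule sum_jump_prob[OF th])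
        show "?r j w \<le> Cp / cp * (TH n w (I (X n w)) / TH n w j)"
          if "j \<in> {1..d}" "TH n w (I (X n w)) < TH n w j" for j
          using jump_prob_up[OF th that] .
        show "TH n w i \<le> TH n w (I (X n w))" by (rule le[OF I_range])
        then show "eta \<le> ?r i w"
          using jump_prob_down[OF th i(1), of "X n w"] eta(2)[OF i(1)] by linarith
        show "TH n w i \<le> e" using le[OF i'(1)] i'(2) by linarith
        show "0 \<le> Cp / cp" using Cp_pos cp by simp
        show "gam (Suc n) \<le> gam n" using gam_mono[OF n] .
      qed (use eta s c e g g0 in auto)
      finally show ?thesis using True by simp
    qed simp
  qed
  finally show ?thesis .
qed

section \<open>Choice of constants and conclusion\<close>

lemma jump_lower_bound:
  "\<exists>eta>0. \<forall>j\<in>{1..d}. eta \<le> cq * (cp / Cp) * measure lam (stratum j)"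
proof -
  let ?S = "(\<lambda>j. cq * (cp / Cp) * measure lam (stratum j)) ` {1..d}"
  have S: "finite ?S" "?S \<noteq> {}" using d_ge by auto
  have "0 < Min ?S"
    using measure_stratum_pos cq cp Cp_pos by (subst Min_gr_iff[OF S]) auto
  moreover have "\<forall>j\<in>{1..d}. Min ?S \<le> cq * (cp / Cp) * measure lam (stratum j)"
    using S(1) by (intro ballI Min_le) auto
  ultimately show ?thesis by blast
qed

text \<open>If the limsup were 0, the smallest weight would stay below \<open>e\<close> from some
  time on and the energy would diverge; the bounded integrals of the energy exclude this almost
  surely.\<close>

lemma AE_limsup_min_pos:
  "AE w in M. limsup (\<lambda>n. ereal (Min (TH n w ` {1..d}))) > 0"
proof -
  obtain eta where eta: "0 < eta"
    "\<And>j. j \<in> {1..d} \<Longrightarrow> eta \<le> cq * (cp / Cp) * measure lam (stratum j)"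
    using jump_lower_bound by blast
  define c where "c = 2 * real d / eta"
  have c0: "0 < c" using eta d_ge by (simp add: c_def)
  define A where "A = 2 * (Cp / cp) * real d"
  have A: "0 < A" using Cp_pos cp d_ge by (simp add: A_def)
  define s where "s = min 1 (eta / A)"
  have "A * s \<le> A * (eta / A)" using A by (intro mult_left_mono) (auto simp: s_def)
  then have s: "0 < s" "s \<le> 1" "A * s \<le> eta"
    using eta A by (auto simp: s_def)
  \<comment> \<open>\<open>b\<close> is the value of \<open>e powr s\<close> for which the condition
    on \<open>e\<close> in the drift holds with equality.\<close>
  define b where "b = 1 / (2 * ((real d + c) * eta))"
  have b: "0 < b" using c0 eta d_ge by (simp add: b_def)
  define e where "e = b powr (1 / s)"
  have e0: "0 < e" using b by (simp add: e_def)
  have "e powr s = b" using b s by (simp add: e_def powr_powr)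
  then have e: "(real d + c) * eta * e powr s \<le> 1/2"
    using c0 eta d_ge by (simp add: b_def)
  define B where "B = 1 / (2 * (2 * real d + c))"
  have B: "0 < B" using c0 by (simp add: B_def)
  have "eventually (\<lambda>n. gam n < min (1/2) B) sequentially"
    using order_tendstoD(2)[OF gam_lim, of "min (1/2) B"] B by simp
  then obtain N0 where N0: "\<And>n. n \<ge> N0 \<Longrightarrow> gam n < min (1/2) B"
    by (auto simp: eventually_sequentially)
  have g: "gam n \<le> 1/2" "(2 * real d + c) * gam n \<le> 1/2" if "n \<ge> N0" for n
  proof -
    show "gam n \<le> 1/2" using N0[OF that] by simp
    have "(2 * real d + c) * gam n \<le> (2 * real d + c) * B"
      using N0[OF that] c0 by (intro mult_left_mono) auto
    also have "\<dots> = 1/2" using c0 by (simp add: B_def)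
    finally show "(2 * real d + c) * gam n \<le> 1/2" .
  qed
  \<comment> \<open>\<open>gam 0\<close> is not constrained in sign or size, so the energy is used
    from time 1 on.\<close>
  define N1 where "N1 = max 1 N0"
  \<comment> \<open>The cutoff \<open>k\<close> on the energy at time \<open>N\<close> replaces
    integrability of the initial energy, about which nothing is assumed. The second condition keeps
    the smallest weight at most \<open>e\<close> during the times \<open>N\<close> to
    \<open>N + n\<close>.\<close>
  define G where "G N k n = {w \<in> space M. V c s N w \<le> real k \<and> (\<forall>m\<in>{..n}. \<exists>i\<in>{1..d}. TH (N + m) w i \<le> e)}"
    for N k n
  have G_Fil: "G N k n \<in> sets (Fil (N + n))" for N k n
  proof -
    have 1: "{w \<in> space (Fil (N + n)). V c s N w \<le> real k} \<in> sets (Fil (N + n))"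
      using measurable_V_Fil by (intro borel_measurable_le) auto
    have 2: "{w \<in> space (Fil (N + n)). \<forall>m\<in>{..n}. \<exists>i\<in>{1..d}. TH (N + m) w i \<le> e} \<in> sets (Fil (N + n))"
      using measurable_TH_Fil
      by (intro sets.sets_Collect_finite_All' sets.sets_Collect_finite_Ex borel_measurable_le) auto
    from sets.sets_Collect_conj[OF 2 1]
    show ?thesis by (simp add: G_def)
  qed
  have G_M: "G N k n \<in> sets M" for N k n
    using G_Fil subalgebra_Fil unfolding subalgebra_def by blast
  have bound: "(\<integral>\<^sup>+w\<in>G N k n. ennreal (V c s (N + n) w) \<partial>M) \<le> ennreal (real k)" if N: "N \<ge> N1" for N k n
  proof (induction n)
    case 0
    have "(\<integral>\<^sup>+w\<in>G N k 0. ennreal (V c s (N + 0) w) \<partial>M) \<le> (\<integral>\<^sup>+w. ennreal (real k) \<partial>M)"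
      by (intro nn_integral_mono) (auto simp: G_def indicator_def intro: ennreal_leI)
    then show ?case by (simp add: emeasure_space_1)
  next
    case (Suc n)
    \<comment> \<open>The events decrease in \<open>n\<close>. Passing to \<open>G N k n\<close>,
      which is known at time \<open>N + n\<close>, makes the drift applicable.\<close>
    have "(\<integral>\<^sup>+w\<in>G N k (Suc n). ennreal (V c s (N + Suc n) w) \<partial>M)
        \<le> (\<integral>\<^sup>+w\<in>G N k n. ennreal (V c s (Suc (N + n)) w) \<partial>M)"
      by (intro nn_integral_mono mult_mono) (auto simp: G_def indicator_def)
    also have "\<dots> \<le> (\<integral>\<^sup>+w\<in>G N k n. ennreal (V c s (N + n) w) \<partial>M)"
      by (rule nn_integral_V_Suc_le[where e = e and eta = eta])
        (use N G_Fil eta s c_def e g in \<open>auto simp: N1_def G_def A_def\<close>)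
    finally show ?case using Suc by simp
  qed
  \<comment> \<open>Only countably many pairs of a starting time \<open>N\<close> and a cutoff
    \<open>k\<close> occur, so one null set suffices for all of them.\<close>
  have "AE w in M. \<forall>N\<in>{N1..}. \<forall>k. (\<forall>n. w \<in> G N k n) \<longrightarrow> \<not> filterlim (\<lambda>n. V c s (N + n) w) at_top sequentially"
    by (intro AE_ball_countable' AE_all_countable[THEN iffD2] allI
        AE_not_at_top_if_bounded_integrals[OF _ G_M bound]
        measurable_from_subalg[OF subalgebra_Fil measurable_V_Fil]) auto
  then have "AE w in M. w \<in> space M \<and> (\<forall>N\<in>{N1..}. \<forall>k. (\<forall>n. w \<in> G N k n) \<longrightarrow> \<not> filterlim (\<lambda>n. V c s (N + n) w) at_top sequentially)"
    by auto
  then show ?thesis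
  proof eventually_elim
    case (elim w)
    then have w: "w \<in> space M" by blast
    show ?case
    proof (rule ccontr)
      assume "\<not> ?case"
      then have lim: "limsup (\<lambda>n. ereal (Min (TH n w ` {1..d}))) \<le> 0" by simp
      have small: "\<exists>N. \<forall>n\<ge>N. \<exists>i\<in>{1..d}. TH n w i < r" if r: "0 < r" for r
      proof -
        have "limsup (\<lambda>n. ereal (Min (TH n w ` {1..d}))) < ereal r"
          using lim r by (auto intro: le_less_trans)
        then have "eventually (\<lambda>n. ereal (Min (TH n w ` {1..d})) < ereal r) sequentially"
          by (rule Limsup_lessD)
        then have "eventually (\<lambda>n. \<exists>i\<in>{1..d}. TH n w i < r) sequentially"
          by eventually_elim (use d_ge in \<open>auto simp: Min_less_iff\<close>)
        then show ?thesis by (simp add: eventually_sequentially)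
      qed
      obtain N2 where N2: "\<And>n. n \<ge> N2 \<Longrightarrow> \<exists>i\<in>{1..d}. TH n w i < e"
        using small[OF e0] by blast
      define N where "N = max N1 N2"
      obtain k where k: "V c s N w \<le> real k" using real_arch_simple by blast
      have "w \<in> G N k n" for n
      proof -
        have "\<exists>i\<in>{1..d}. TH (N + m) w i \<le> e" for m
        proof -
          have "N2 \<le> N + m" by (simp add: N_def)
          from N2[OF this] show ?thesis by (auto intro: less_imp_le)
        qed
        with w k show ?thesis by (simp add: G_def)
      qed
      moreover have "filterlim (\<lambda>n. V c s (N + n) w) at_top sequentially"
        unfolding filterlim_at_top
      proof
        fix L :: real
        \<comment> \<open>A weight below \<open>exp (- L)\<close> contributes more than
          \<open>L\<close> to the energy.\<close>
        obtain N3 where N3: "\<And>n. n \<ge> N3 \<Longrightarrow> \<exists>i\<in>{1..d}. TH n w i < exp (- L)"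
          using small[of "exp (- L)"] by auto
        have "L \<le> V c s (N + n) w" if n: "n \<ge> N3" for n
        proof -
          obtain i where i: "i \<in> {1..d}" "TH (N + n) w i < exp (- L)"
            using N3[of "N + n"] n by auto
          have "ln (TH (N + n) w i) \<le> - L"
            using i ThetaD[OF TH_Theta[OF w] i(1)] by (metis exp_gt_zero less_imp_le ln_exp ln_le_cancel_iff)
          moreover have "- ln (TH (N + n) w i) \<le> V c s (N + n) w"
            unfolding V_def using gam_range[of "N + n"] c0
            by (intro neg_ln_le_lyap TH_Theta w i) (auto simp: N_def N1_def)
          ultimately show ?thesis by linarith
        qed
        then show "eventually (\<lambda>n. L \<le> V c s (N + n) w) sequentially"
          by (auto simp: eventually_sequentially)
      qed
      moreover have "N \<in> {N1..}" by (simp add: N_def)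
      ultimately show False using elim by blast
    qed
  qed
qed

end
theorem theorem1:
  fixes lam :: "'a::polish_space measure"
    and p :: "'a \<Rightarrow> real"
    and d :: nat
    and I :: "'a \<Rightarrow> nat"
    and q :: "'a \<Rightarrow> 'a \<Rightarrow> real"
    and gam :: "nat \<Rightarrow> real"
    and M :: "'b measure"
    and X :: "nat \<Rightarrow> 'b \<Rightarrow> 'a"
    and th0 :: "'b \<Rightarrow> nat \<Rightarrow> real"
  assumes lam_borel: "sets lam = sets borel"
    and lam_sf: "sigma_finite_measure lam"
    and p_meas: "p \<in> borel_measurable lam"
    and p_nonneg: "\<And>x. 0 \<le> p x"
    and p_int: "integrable lam p"
    and p_prob: "(LINT x|lam. p x) = 1"
    and d_ge: "d \<ge> 2"
    and I_meas: "I \<in> measurable lam (count_space UNIV)"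
    and I_range: "\<And>x. I x \<in> {1..d}"
    \<comment> \<open>(A1)\<close>
    and A1_inf: "\<exists>c>0. \<forall>x. c \<le> p x"
    and A1_sup: "\<exists>C. \<forall>x. p x \<le> C"
    and A1_star: "\<And>i. i \<in> {1..d} \<Longrightarrow> theta_star lam p I i > 0"
    \<comment> \<open>(A2): symmetric proposal density with positive infimum\<close>
    and q_meas: "(\<lambda>(x, y). q x y) \<in> borel_measurable (lam \<Otimes>\<^sub>M lam)"
    and q_nonneg: "\<And>x y. 0 \<le> q x y"
    and q_int: "\<And>x. integrable lam (q x)"
    and q_dens: "\<And>x. (LINT y|lam. q x y) = 1"
    and q_sym: "\<And>x y. q x y = q y x"
    and q_inf: "\<exists>c>0. \<forall>x y. c \<le> q x y"
    \<comment> \<open>step sizes\<close>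
    and gam_range: "\<And>n. n \<ge> 1 \<Longrightarrow> 0 \<le> gam n \<and> gam n < 1"
    and gam_mono: "\<And>n. n \<ge> 1 \<Longrightarrow> gam (Suc n) \<le> gam n"
    and gam_lim: "gam \<longlonglongrightarrow> 0"
    \<comment> \<open>the linearized Wang--Landau process on a probability space\<close>
    and M_prob: "prob_space M"
    and X_meas: "\<And>n. X n \<in> measurable M lam"
    and th0_meas: "\<And>i. (\<lambda>w. th0 w i) \<in> borel_measurable M"
    and th0_Theta: "\<And>w. w \<in> space M \<Longrightarrow> th0 w \<in> Theta d"
    and X_trans: "\<And>n B A. B \<in> sets lam \<Longrightarrow>
         A \<in> sigma_sets (space M) (F_gen M d X th0 n) \<Longrightarrow>
         measure M (A \<inter> (X (Suc n) -` B \<inter> space M)) =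
         (LINT w:A|M. MH_kernel lam q
              (pi_theta lam p I d (theta_seq gam I (th0 w) (\<lambda>k. X k w) n))
              (X n w) B)"
  shows "measure M {w \<in> space M.
           limsup (\<lambda>n. ereal (Min ((\<lambda>j. theta_seq gam I (th0 w) (\<lambda>k. X k w) n j) ` {1..d}))) > 0} = 1"
proof -
  obtain cp where cp: "0 < cp" "\<And>x. cp \<le> p x" using A1_inf by blast
  obtain Cp where Cp: "\<And>x. p x \<le> Cp" using A1_sup by blast
  obtain cq where cq: "0 < cq" "\<And>x y. cq \<le> q x y" using q_inf by blast
  interpret M: prob_space M by (rule M_prob)
  interpret wl_process lam p d I q cp Cp cq M gam X th0
    by (intro wl_process.intro mh_strata.intro wl_process_axioms.intro)
      (fact M_prob lam_borel lam_sf p_meas p_int d_ge I_meas I_range cp Cp A1_star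
        q_meas q_nonneg q_int q_dens cq gam_range gam_mono gam_lim X_meas th0_meas th0_Theta X_trans)+
  have [measurable]: "(\<lambda>w. TH n w j) \<in> borel_measurable M" if "j \<in> {1..d}" for n j
    using measurable_from_subalg[OF subalgebra_Fil measurable_TH_Fil[OF that order_refl]] .
  have "(\<lambda>w. ereal (Min (TH n w ` {1..d}))) \<in> borel_measurable M" for n
    by (intro borel_measurable_ereal borel_measurable_Min) auto
  then have "(\<lambda>w. limsup (\<lambda>n. ereal (Min (TH n w ` {1..d})))) \<in> borel_measurable M"
    by (rule borel_measurable_limsup)
  \<comment> \<open>Measurability of the event turns the almost sure statement into one about its
    probability.\<close>
  then have "{w \<in> space M. limsup (\<lambda>n. ereal (Min (TH n w ` {1..d}))) > 0} \<in> sets M"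
    by (intro borel_measurable_less) auto
  then have "measure M {w \<in> space M. limsup (\<lambda>n. ereal (Min (TH n w ` {1..d}))) > 0} = 1"
    using AE_limsup_min_pos by (intro M.prob_Collect_eq_1[THEN iffD2])
  then show ?thesis by (simp add: TH_def)
qed

end
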